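(* For every integer $m\ge 1$, the following identities hold in $\mathbf U$: \[ \mathfrak t_{\mathrm{ev}}^{(2m)} = \sum_{c=0}^m \sum_{a=0}^{2m-2c} q^{\binom{2c}{2} -a(2m-2c-a)}\, \check E^{(a)} \begin{bmatrix} h;1-m\\ c\end{bmatrix} F^{(2m-2c-a)}, \] \[ \mathfrak t_{\mathrm{ev}}^{(2m-1)} = \sum_{c=0}^{m-1} \sum_{a=0}^{2m-1-2c} q^{\binom{2c+1}{2} -a(2m-1-2c-a)}\, \check E^{(a)} \begin{bmatrix} h;1-m\\ c\end{bmatrix} F^{(2m-1-2c-a)}. \]
   Context: $\mathbf U=\mathbf U_q(\mathfrak{sl}_2)$ is the $\mathbb Q(q)$-algebra generated by $E,F,K,K^{-1}$ with relations $KK^{-1}=K^{-1}K=1$, $EF-FE=\frac{K-K^{-1}}{q-q^{-1}}$, $KE=q^2EK$, $KF=q^{-2}FK$. For $n\in\mathbb Z$, $[n]=\frac{q^n-q^{-n}}{q-q^{-1}}$, and $[n]!=[1][2]\cdots[n]$ for $n\ge 0$ (with $[0]!=1$). Put $\check E=q^{-1}EK^{-1}$, $h=\frac{K^{-2}-1}{q^2-1}$, $\mathfrak t=\check E+F$, and $\check E^{(n)}=\check E^n/[n]!$, $F^{(n)}=F^n/[n]!$ for $n\ge 0$. For $a\in\mathbb Z$, $n\ge 0$, \[ \begin{bmatrix} h;a\\ n\end{bmatrix}=\prod_{i=1}^n\frac{q^{4a+4i-4}K^{-2}-1}{q^{4i}-1} \] (an empty product is $1$). In exponents, $\binom{x}{2}=x(x-1)/2$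 for integers $x$. The $\imath$-divided powers $\mathfrak t_{\mathrm{ev}}^{(n)}$ are the polynomials in $\mathfrak t$ given by $\mathfrak t_{\mathrm{ev}}^{(0)}=1$, \[ \mathfrak t_{\mathrm{ev}}^{(2a)}=\frac{1}{[2a]!}\,\mathfrak t\prod_{i=1-a}^{a-1}(\mathfrak t-[2i])\ (a\ge 1),\qquad \mathfrak t_{\mathrm{ev}}^{(2a+1)}=\frac{1}{[2a+1]!}\prod_{i=-a}^{a}(\mathfrak t-[2i])\ (a\ge 0). \] Equivalently, $\mathfrak t_{\mathrm{ev}}^{(0)}=1$, $\mathfrak t_{\mathrm{ev}}^{(1)}=\mathfrak t$, and for $a\ge 1$: $\mathfrak t\cdot \mathfrak t_{\mathrm{ev}}^{(2a-1)}=[2a]\,\mathfrak t_{\mathrm{ev}}^{(2a)}$, $\mathfrak t\cdot\mathfrak t_{\mathrm{ev}}^{(2a)}=[2a+1]\,\mathfrak t_{\mathrm{ev}}^{(2a+1)}+[2a]\,\mathfrak t_{\mathrm{ev}}^{(2a-1)}$. *)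

theory Defs
  imports
    Complex_Main
    "HOL-Library.Poly_Mapping"
    "HOL-Computational_Algebra.Polynomial"
    "HOL-Computational_Algebra.Fraction_Field"
begin

section \<open>The field of rational functions and quantum integers\<close>

type_synonym Qq = "rat poly fract"

definition q :: Qq where
  "q = Fract [:0, 1:] 1"

definition qint :: "int \<Rightarrow> Qq" where
  "qint n = (q powi n - q powi (- n)) / (q - inverse q)"

definition qfact :: "nat \<Rightarrow> Qq" where
  "qfact n = (\<Prod>i = 1..n. qint (int i))"

definition binom2 :: "int \<Rightarrow> int" where
  "binom2 x = x * (x - 1) div 2"

text \<open>Sanity check: no denominator occurring below vanishes.\<close>

lemma q_nonzero [simp]: "q \<noteq> 0"
  by (simp add: q_def Zero_fract_def eq_fract)

lemma q_power: "q ^ n = Fract (monom 1 n) 1"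
  by (induction n)
    (simp_all add: q_def One_fract_def monom_altdef mult.commute one_pCons)

lemma q_power_neq_1: "n > 0 \<Longrightarrow> q ^ n \<noteq> 1"
  by (simp add: q_power One_fract_def eq_fract monom_eq_1_iff)

lemma qint_nonzero:
  assumes "n > 0"
  shows "qint (int n) \<noteq> 0"
proof -
  have "q ^ n \<noteq> inverse (q ^ n)" if "n > 0" for n
  proof
    assume "q ^ n = inverse (q ^ n)"
    then have "q ^ n * q ^ n = 1"
      by (metis q_nonzero power_not_zero right_inverse)
    then have "q ^ (n + n) = 1"
      by (simp add: power_add)
    with q_power_neq_1[of "n + n"] that show False
      by simp
  qed
  from this[of n] this[of 1] assms show ?thesis
    by (simp add: qint_def power_int_minus)
qed

lemma qfact_nonzero: "qfact n \<noteq> 0"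
  by (simp add: qfact_def qint_nonzero)

section \<open>The quantized enveloping algebra of sl2\<close>

datatype gen = genE | genF | genK | genKinv

datatype word = Word (letters: "gen list")

text \<open>The free monoid, written additively because multiplication on
  \<^typ>\<open>'a \<Rightarrow>\<^sub>0 'b\<close> is convolution over an additive monoid of exponents.\<close>

instantiation word :: monoid_add
begin

definition zero_word :: word where
  "0 = Word []"

definition plus_word :: "word \<Rightarrow> word \<Rightarrow> word" where
  "v + w = Word (letters v @ letters w)"

instance
  by standard (simp_all add: zero_word_def plus_word_def)

end

type_synonym free_alg = "word \<Rightarrow>\<^sub>0 Qq"

definition fgen :: "gen \<Rightarrow> free_alg" where
  "fgen g = Poly_Mapping.single (Word [g]) 1"

definition fscal :: "Qq \<Rightarrow> free_alg" where
  "fscal c = Poly_Mapping.single 0 c"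

inductive_set ideal_generated :: "'a::ring_1 set \<Rightarrow> 'a set" for R where
  zero: "0 \<in> ideal_generated R"
| generator: "r \<in> R \<Longrightarrow> a * r * b \<in> ideal_generated R"
| add: "x \<in> ideal_generated R \<Longrightarrow> y \<in> ideal_generated R \<Longrightarrow> x + y \<in> ideal_generated R"

definition U_relations :: "free_alg set" where
  "U_relations =
    {fgen genK * fgen genKinv - 1,
     fgen genKinv * fgen genK - 1,
     fgen genE * fgen genF - fgen genF * fgen genE
       - fscal (1 / (q - inverse q)) * (fgen genK - fgen genKinv),
     fgen genK * fgen genE - fscal (q ^ 2) * (fgen genE * fgen genK),
     fgen genK * fgen genF - fscal (q powi (- 2)) * (fgen genF * fgen genK)}"

definition U_ideal :: "free_alg set" where
  "U_ideal = ideal_generated U_relations"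

definition U_rel :: "free_alg \<Rightarrow> free_alg \<Rightarrow> bool" where
  "U_rel x y \<longleftrightarrow> x - y \<in> U_ideal"

lemma ideal_generated_mult_left:
  "x \<in> ideal_generated R \<Longrightarrow> a * x \<in> ideal_generated R"
proof (induction rule: ideal_generated.induct)
  case (generator r b c)
  then show ?case
    using ideal_generated.generator[of r R "a * b" c] by (simp add: mult.assoc)
qed (auto simp: distrib_left intro: ideal_generated.intros)

lemma ideal_generated_mult_right:
  "x \<in> ideal_generated R \<Longrightarrow> x * a \<in> ideal_generated R"
proof (induction rule: ideal_generated.induct)
  case (generator r b c)
  then show ?case
    using ideal_generated.generator[of r R b "c * a"] by (simp add: mult.assoc)
qed (auto simp: distrib_right intro: ideal_generated.intros)

lemma ideal_generated_minus:
  "x \<in> ideal_generated R \<Longrightarrow> - x \<in> ideal_generated R"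
  using ideal_generated_mult_left[of x R "- 1"] by simp

lemma U_rel_add: "U_rel x y \<Longrightarrow> U_rel x' y' \<Longrightarrow> U_rel (x + x') (y + y')"
  unfolding U_rel_def U_ideal_def add_diff_add by (rule ideal_generated.add)

lemma U_rel_minus: "U_rel x y \<Longrightarrow> U_rel (- x) (- y)"
  using ideal_generated_minus[of "x - y"] by (simp add: U_rel_def U_ideal_def)

lemma U_rel_mult:
  assumes "U_rel x y" "U_rel x' y'"
  shows "U_rel (x * x') (y * y')"
proof -
  have "x * x' - y * y' = (x - y) * x' + y * (x' - y')"
    by (simp add: algebra_simps)
  with assms show ?thesis
    by (auto simp: U_rel_def U_ideal_def intro: ideal_generated.add
        ideal_generated_mult_left ideal_generated_mult_right)
qed

lemma equivp_U_rel: "equivp U_rel"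
proof (rule equivpI)
  show "reflp U_rel"
    by (rule reflpI) (simp add: U_rel_def U_ideal_def ideal_generated.zero)
  show "symp U_rel"
    by (rule sympI) (metis U_rel_def U_ideal_def ideal_generated_minus minus_diff_eq)
  show "transp U_rel"
  proof (rule transpI)
    fix x y z
    assume "U_rel x y" "U_rel y z"
    then show "U_rel x z"
      using ideal_generated.add[of "x - y" U_relations "y - z"]
      by (simp add: U_rel_def U_ideal_def)
  qed
qed

lemma free_alg_induct [case_names zero single add]:
  fixes x :: "'a \<Rightarrow>\<^sub>0 'b::ab_group_add"
  assumes zero: "P 0"
    and single: "\<And>w c. P (Poly_Mapping.single w c)"
    and add: "\<And>x y. P x \<Longrightarrow> P y \<Longrightarrow> P (x + y)"
  shows "P x"
proof (induction x rule: update_induct)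
  case const
  show ?case by (rule zero)
next
  case (update f w c)
  have "Poly_Mapping.update w c f = f + Poly_Mapping.single w c"
    using update(1)
    by (intro poly_mapping_eqI) (auto simp: lookup_update lookup_add lookup_single in_keys_iff when_def)
  then show ?case
    using add[OF update(3) single] by simp
qed

text \<open>The counit, sending \<open>E, F\<close> to \<open>0\<close> and \<open>K, K\<^sup>-\<^sup>1\<close> to \<open>1\<close>. It is used
  only to see that the quotient is not the zero ring, as the class
  \<^class>\<open>ring_1\<close> demands.\<close>

definition word_counit :: "word \<Rightarrow> Qq" where
  "word_counit w = (if set (letters w) \<subseteq> {genK, genKinv} then 1 else 0)"

definition counit :: "free_alg \<Rightarrow> Qq" where
  "counit p = (\<Sum>w\<in>Poly_Mapping.keys p. Poly_Mapping.lookup p w * word_counit w)"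

lemma counit_superset:
  assumes "finite A" "Poly_Mapping.keys p \<subseteq> A"
  shows "counit p = (\<Sum>w\<in>A. Poly_Mapping.lookup p w * word_counit w)"
  unfolding counit_def using assms
  by (intro sum.mono_neutral_left) (auto simp: in_keys_iff)

lemma counit_add: "counit (x + y) = counit x + counit y"
proof -
  let ?A = "Poly_Mapping.keys x \<union> Poly_Mapping.keys y"
  have "Poly_Mapping.keys (x + y) \<subseteq> ?A"
    by (rule Poly_Mapping.keys_add)
  then show ?thesis
    by (simp add: counit_superset[of ?A] lookup_add distrib_right sum.distrib)
qed

lemma counit_0: "counit 0 = 0"
  by (simp add: counit_def)

lemma counit_single: "counit (Poly_Mapping.single w c) = c * word_counit w"
  by (cases "c = 0") (simp_all add: counit_def)

lemma counit_diff: "counit (x - y) = counit x - counit y"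
  using counit_add[of "x - y" y] by simp

lemma word_counit_add: "word_counit (v + w) = word_counit v * word_counit w"
  by (simp add: word_counit_def plus_word_def)

lemma counit_mult: "counit (x * y) = counit x * counit y"
proof -
  have single_mult: "counit (Poly_Mapping.single v c * y) = c * word_counit v * counit y" for v c
  proof (induction y rule: free_alg_induct)
    case zero
    then show ?case
      by (simp add: counit_0)
  next
    case (single w d)
    then show ?case
      by (simp add: mult_single counit_single word_counit_add)
  next
    case (add f g)
    then show ?case
      by (simp add: distrib_left counit_add)
  qed
  show ?thesis
  proof (induction x rule: free_alg_induct)
    case zero
    then show ?case
      by (simp add: counit_0)
  next
    case (single w d)
    then show ?case
      by (simp add: single_mult counit_single)
  next
    case (add f g)
    then show ?case
      by (simp add: distrib_right counit_add)
  qed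
qed

lemma counit_1: "counit 1 = 1"
  unfolding single_one[symmetric] counit_single by (simp add: word_counit_def zero_word_def)

lemma counit_relation: "r \<in> U_relations \<Longrightarrow> counit r = 0"
  by (auto simp: U_relations_def counit_diff counit_mult counit_1 fgen_def fscal_def
      counit_single word_counit_def)

lemma counit_U_ideal: "x \<in> U_ideal \<Longrightarrow> counit x = 0"
  unfolding U_ideal_def
  by (induction rule: ideal_generated.induct)
    (simp_all add: counit_0 counit_add counit_mult counit_relation)

quotient_type U = free_alg / U_rel
  by (rule equivp_U_rel)

instantiation U :: ring_1
begin

lift_definition zero_U :: U is 0 .
lift_definition one_U :: U is 1 .
lift_definition plus_U :: "U \<Rightarrow> U \<Rightarrow> U" is "(+)"
  by (rule U_rel_add)
lift_definition uminus_U :: "U \<Rightarrow> U" is uminus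
  by (rule U_rel_minus)
lift_definition minus_U :: "U \<Rightarrow> U \<Rightarrow> U" is "(-)"
  unfolding diff_conv_add_uminus by (intro U_rel_add U_rel_minus)
lift_definition times_U :: "U \<Rightarrow> U \<Rightarrow> U" is "(*)"
  by (rule U_rel_mult)

instance
proof
  show "(0 :: U) \<noteq> 1"
  proof (transfer, rule notI)
    assume "U_rel 0 1"
    then have "counit (0 - 1) = 0"
      unfolding U_rel_def by (rule counit_U_ideal)
    then show False
      unfolding counit_diff by (simp add: counit_0 counit_1)
  qed
qed (transfer, simp add: algebra_simps U_rel_def U_ideal_def ideal_generated.zero)+

end

lift_definition scaleU :: "Qq \<Rightarrow> U \<Rightarrow> U" (infixr \<open>\<odot>\<close> 75) is "\<lambda>c x. fscal c * x"
  by (rule U_rel_mult) (simp_all add: U_rel_def U_ideal_def ideal_generated.zero)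

lift_definition E :: U is "fgen genE" .
lift_definition F :: U is "fgen genF" .
lift_definition K :: U is "fgen genK" .
lift_definition Kinv :: U is "fgen genKinv" .

lemma fscal_commute: "fscal c * x = x * fscal c"
  by (induction x rule: free_alg_induct)
    (simp_all add: fscal_def mult_single distrib_left distrib_right mult.commute)

lemma U_rel_refl: "U_rel x x"
  by (simp add: U_rel_def U_ideal_def ideal_generated.zero)

text \<open>\<^typ>\<open>U\<close> is an algebra over \<^typ>\<open>Qq\<close>.\<close>

lemma scaleU_add_right: "c \<odot> (x + y) = c \<odot> x + c \<odot> y"
  by transfer (simp add: distrib_left U_rel_refl)

lemma scaleU_add_left: "(c + d) \<odot> x = c \<odot> x + d \<odot> x"
  by transfer (simp add: fscal_def single_add distrib_right U_rel_refl)

lemma scaleU_scaleU: "c \<odot> d \<odot> x = (c * d) \<odot> x"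
  by transfer (simp add: fscal_def mult_single mult.assoc[symmetric] U_rel_refl)

lemma scaleU_one: "1 \<odot> x = x"
  by transfer (simp add: fscal_def U_rel_refl)

lemma scaleU_mult_left: "(c \<odot> x) * y = c \<odot> (x * y)"
  by transfer (simp add: mult.assoc U_rel_refl)

lemma scaleU_mult_right: "x * (c \<odot> y) = c \<odot> (x * y)"
  by transfer (metis fscal_commute mult.assoc U_rel_refl)

lemma U_rel_relation: "x - y \<in> U_relations \<Longrightarrow> U_rel x y"
  unfolding U_rel_def U_ideal_def
  using ideal_generated.generator[of "x - y" U_relations 1 1] by simp

lemma K_Kinv: "K * Kinv = 1"
  by transfer (simp add: U_rel_relation U_relations_def)

lemma Kinv_K: "Kinv * K = 1"
  by transfer (simp add: U_rel_relation U_relations_def)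

lemma E_F_commutator: "E * F - F * E = (1 / (q - inverse q)) \<odot> (K - Kinv)"
  by transfer (simp add: U_rel_relation U_relations_def)

lemma K_E: "K * E = q ^ 2 \<odot> (E * K)"
  by transfer (simp add: U_rel_relation U_relations_def)

lemma K_F: "K * F = q powi (- 2) \<odot> (F * K)"
  by transfer (rule U_rel_relation, simp add: U_relations_def)

section \<open>Divided powers\<close>

definition Echeck :: U where
  "Echeck = inverse q \<odot> (E * Kinv)"

definition Echeck_dp :: "nat \<Rightarrow> U" where
  "Echeck_dp n = (1 / qfact n) \<odot> Echeck ^ n"

definition F_dp :: "nat \<Rightarrow> U" where
  "F_dp n = (1 / qfact n) \<odot> F ^ n"

definition h :: U where
  "h = (1 / (q ^ 2 - 1)) \<odot> (Kinv ^ 2 - 1)"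

text \<open>The symbol \<open>[h; a; n]\<close>, which depends on \<^const>\<open>h\<close> through
  \<open>K\<^sup>-\<^sup>2 = 1 + (q\<^sup>2 - 1) h\<close>. As \<^const>\<open>prod\<close> needs a commutative monoid, products
  in \<^typ>\<open>U\<close> are written as products of lists; their factors commute, so the
  order is immaterial.\<close>

definition hbinom :: "int \<Rightarrow> nat \<Rightarrow> U" where
  "hbinom a n =
    (\<Prod>i\<leftarrow>[1..int n].
      (1 / (q powi (4 * i) - 1)) \<odot> (q powi (4 * a + 4 * i - 4) \<odot> Kinv ^ 2 - 1))"

lemma Kinv_square_eq: "Kinv ^ 2 = 1 + (q ^ 2 - 1) \<odot> h"
  using q_power_neq_1[of 2] by (simp add: h_def scaleU_scaleU scaleU_one)

definition t :: U where
  "t = Echeck + F"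

definition t_ev :: "nat \<Rightarrow> U" where
  "t_ev n =
    (if n = 0 then 1
     else let a = int (n div 2) in
       if even n
       then (1 / qfact n) \<odot> (t * (\<Prod>i\<leftarrow>[1 - a..a - 1]. t - qint (2 * i) \<odot> 1))
       else (1 / qfact n) \<odot> (\<Prod>i\<leftarrow>[- a..a]. t - qint (2 * i) \<odot> 1))"

end

theory Submission
  imports Defs
begin

text \<open>Both sides satisfy the same recursion under left multiplication by \<open>t = Echeck + F\<close>. For
  the divided powers it reads
  \<open>t * t_ev (2 * m - 1) = [2m] t_ev (2 * m)\<close> and
  \<open>t * t_ev (2 * m) = [2m + 1] t_ev (2 * m + 1) + [2m] t_ev (2 * m - 1)\<close>, which follows from their
  product formulas (\<open>t_mult_t_ev_odd\<close>, \<open>t_mult_t_ev_even\<close>). As quantum integers are invertible, it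
  determines all \<open>t_ev n\<close> from \<open>t_ev 1 = t\<close>.

  The right-hand sides are sums of monomials ordered as powers of \<open>Echeck\<close>, then a polynomial in
  \<open>Kinv ^ 2\<close>, then powers of \<open>F\<close>. To multiply such a monomial by \<open>t\<close> and reorder it, two
  rules suffice: \<open>F\<close> passes \<open>hbinom r c\<close> by turning \<open>r\<close> into \<open>r - 1\<close> (\<open>F_hbinom\<close>),
  and it passes \<open>Echeck_dp n\<close> up to a scalar and a correction \<open>Echeck_dp (n - 1)\<close> times a
  polynomial of degree one in \<open>Kinv ^ 2\<close> (\<open>F_Echeck_dp\<close>). Hence the coefficient of
  \<open>Echeck_dp a\<close> and \<open>F_dp b\<close> in the product is a sum of three terms
  (\<open>t_mult_ordered_sum\<close>).

  For \<open>c > 0\<close> these terms contain \<open>hbinom r c\<close>, \<open>hbinom (r - 1) c\<close> and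
  \<open>hbinom r (c - 1)\<close> times a polynomial of degree one. The numerators of a bracket are consecutive, so
  \<open>hbinom r (c - 1)\<close> divides all three with quotients of degree one in \<open>Kinv ^ 2\<close>
  (\<open>hbinom_Suc\<close>, \<open>hbinom_shift_Suc\<close>). What is left to check is therefore an
  identity between polynomials of degree one, that is, two rational identities in
  \<open>q ^ a\<close>, \<open>q ^ b\<close>, \<open>q ^ c\<close> and \<open>q\<close> for each parity
  (\<open>next_coeff_odd_to_even\<close>, \<open>next_coeff_even_to_odd\<close>).\<close>

section \<open>Scalars\<close>

lemma scaleU_zero_left [simp]: "0 \<odot> x = 0"
  using scaleU_add_left[of 0 0 x] by simp

lemma scaleU_zero_right [simp]: "c \<odot> 0 = 0"
  using scaleU_add_right[of c 0 0] by simp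

lemma scaleU_minus_left: "(- c) \<odot> x = - (c \<odot> x)"
  using scaleU_add_left[of c "- c" x] by (simp add: eq_neg_iff_add_eq_0 add.commute)

lemma scaleU_minus_right: "c \<odot> (- x) = - (c \<odot> x)"
  using scaleU_add_right[of c x "- x"] by (simp add: eq_neg_iff_add_eq_0 add.commute)

lemma scaleU_diff_right: "c \<odot> (x - y) = c \<odot> x - c \<odot> y"
  using scaleU_add_right[of c x "- y"] by (simp add: scaleU_minus_right)

lemma scaleU_sum_right: "c \<odot> (\<Sum>i\<in>A. f i) = (\<Sum>i\<in>A. c \<odot> f i)"
  by (induction A rule: infinite_finite_induct) (simp_all add: scaleU_add_right)

lemmas scaleU_simps = scaleU_scaleU scaleU_one scaleU_mult_left scaleU_mult_right

lemma q_square_neq_1: "q ^ 2 \<noteq> 1"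
  using q_power_neq_1[of 2] by simp

lemma q_minus_inverse_q_nonzero: "q - inverse q \<noteq> 0"
  using q_square_neq_1 by (simp add: field_simps power2_eq_square)

lemma qfact_Suc: "qfact (Suc n) = qint (int (Suc n)) * qfact n"
  by (simp add: qfact_def mult.commute)

section \<open>Commutation relations\<close>

lemma Kinv_E: "Kinv * E = (1 / q ^ 2) \<odot> (E * Kinv)"
proof -
  have "E * Kinv = Kinv * (K * E) * Kinv"
    by (simp add: mult.assoc[symmetric] Kinv_K)
  also have "\<dots> = q ^ 2 \<odot> (Kinv * E)"
    by (simp add: K_E scaleU_simps mult.assoc K_Kinv)
  finally show ?thesis by (simp add: scaleU_simps)
qed

lemma Kinv_F: "Kinv * F = q ^ 2 \<odot> (F * Kinv)"
proof -
  have "F * Kinv = Kinv * (K * F) * Kinv"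
    by (simp add: mult.assoc[symmetric] Kinv_K)
  also have "\<dots> = q powi (- 2) \<odot> (Kinv * F)"
    by (simp add: K_F scaleU_simps mult.assoc K_Kinv)
  finally show ?thesis by (simp add: scaleU_simps power_int_minus)
qed

text \<open>Everything below happens inside the subalgebra generated by \<open>Echeck\<close>, \<open>F\<close> and
  \<open>Kinv ^ 2\<close>; the next three lemmas say how these generators commute, and \<open>E\<close> and \<open>K\<close> do not
  occur any more once they are known.\<close>

lemma F_Kinv_square: "F * Kinv ^ 2 = (1 / q ^ 4) \<odot> (Kinv ^ 2 * F)"
proof -
  have *: "Kinv * (F * x) = q ^ 2 \<odot> (F * (Kinv * x))" for x
    by (simp add: mult.assoc[symmetric] Kinv_F scaleU_simps)
  have "Kinv ^ 2 * F = q ^ 4 \<odot> (F * Kinv ^ 2)"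
    by (simp add: power2_eq_square mult.assoc Kinv_F * scaleU_simps eval_nat_numeral)
  then show ?thesis by (simp add: scaleU_simps)
qed

lemma Kinv_square_Echeck: "Kinv ^ 2 * Echeck = (1 / q ^ 4) \<odot> (Echeck * Kinv ^ 2)"
proof -
  have *: "Kinv * (E * x) = (1 / q ^ 2) \<odot> (E * (Kinv * x))" for x
    by (simp add: mult.assoc[symmetric] Kinv_E scaleU_simps)
  show ?thesis
    by (simp add: Echeck_def power2_eq_square mult.assoc * scaleU_simps eval_nat_numeral)
qed

lemma F_Echeck: "F * Echeck = (1 / q ^ 2) \<odot> (Echeck * F) + h"
proof -
  have "Echeck * F = q \<odot> (E * F * Kinv)"
    by (simp add: Echeck_def scaleU_simps mult.assoc Kinv_F power2_eq_square)
      (simp add: mult.assoc[symmetric])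
  also have "E * F = F * E + (1 / (q - inverse q)) \<odot> (K - Kinv)"
    using E_F_commutator by (simp add: algebra_simps)
  finally have "(1 / q ^ 2) \<odot> (Echeck * F) =
      F * Echeck + (1 / q * (1 / (q - inverse q))) \<odot> (1 - Kinv ^ 2)"
    by (simp add: scaleU_simps distrib_right left_diff_distrib K_Kinv scaleU_add_right Echeck_def mult.assoc
       power2_eq_square inverse_eq_divide)
  also have "1 / q * (1 / (q - inverse q)) = 1 / (q ^ 2 - 1)"
    using q_square_neq_1 q_minus_inverse_q_nonzero by (simp add: field_simps power2_eq_square)
  also have "(1 / (q ^ 2 - 1)) \<odot> (1 - Kinv ^ 2) = - h"
    by (simp add: h_def scaleU_diff_right)
  finally show ?thesis by simp
qed

text \<open>The brackets \<open>hbinom\<close> are products of polynomials of degree one in \<open>Kinv ^ 2\<close>, and moving \<open>F\<close>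
  past a power of \<open>Echeck\<close> creates one factor of this kind. An identity between such factors
  amounts to a pair of scalar identities, one for each coefficient.\<close>

definition lin_Kinv2 :: "Qq \<Rightarrow> Qq \<Rightarrow> U" where
  "lin_Kinv2 x y = x \<odot> Kinv ^ 2 + y \<odot> 1"

lemma lin_Kinv2_add:
  "lin_Kinv2 x y + lin_Kinv2 x' y' = lin_Kinv2 (x + x') (y + y')"
  by (simp add: lin_Kinv2_def scaleU_add_left)

lemma scaleU_lin_Kinv2:
  "c \<odot> lin_Kinv2 x y = lin_Kinv2 (c * x) (c * y)"
  by (simp add: lin_Kinv2_def scaleU_add_right scaleU_simps)

lemma lin_Kinv2_commute:
  "lin_Kinv2 x y * lin_Kinv2 x' y' = lin_Kinv2 x' y' * lin_Kinv2 x y"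
  by (simp add: lin_Kinv2_def distrib_left distrib_right scaleU_simps scaleU_add_right ac_simps)

lemma h_eq_lin_Kinv2: "h = lin_Kinv2 (1 / (q ^ 2 - 1)) (- 1 / (q ^ 2 - 1))"
  by (simp add: h_def lin_Kinv2_def scaleU_diff_right scaleU_minus_left)

lemma lin_Kinv2_Echeck_power:
  "lin_Kinv2 x y * Echeck ^ n = Echeck ^ n * lin_Kinv2 (x / q ^ (4 * n)) y"
proof (induction n arbitrary: x)
  case (Suc n)
  have "lin_Kinv2 x y * Echeck = Echeck * lin_Kinv2 (x / q ^ 4) y"
    by (simp add: lin_Kinv2_def distrib_left distrib_right scaleU_simps Kinv_square_Echeck)
  then show ?case
    by (simp add: mult.assoc[symmetric]) (simp add: mult.assoc Suc power_add[symmetric] field_simps)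
qed simp

lemma F_lin_Kinv2: "F * lin_Kinv2 x y = lin_Kinv2 (x / q ^ 4) y * F"
  by (simp add: lin_Kinv2_def distrib_left distrib_right scaleU_simps F_Kinv_square)

text \<open>Moving \<open>F\<close> through \<open>Echeck ^ Suc n\<close> one factor at a time leaves, besides the leading
  term, the sum over \<open>j \<le> n\<close> of \<open>q powi (- 2 * j) \<odot> (Echeck ^ j * h * Echeck ^ (n - j))\<close>; commuting each \<open>h\<close> to the right of the powers of
  \<open>Echeck\<close> rescales \<open>Kinv ^ 2\<close>, and the two coefficients become geometric sums, that is,
  multiples of a quantum integer.\<close>

lemma F_Echeck_power:
  "F * Echeck ^ Suc n = (1 / q ^ (2 * Suc n)) \<odot> (Echeck ^ Suc n * F)
     + (qint (int (Suc n)) / (q ^ 2 - 1)) \<odot> (Echeck ^ n * lin_Kinv2 (1 / q ^ (3 * n)) (- 1 / q ^ n))"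
proof (induction n)
  case 0
  show ?case
    using q_minus_inverse_q_nonzero
    by (simp add: F_Echeck h_eq_lin_Kinv2 scaleU_lin_Kinv2 qint_def power_int_minus)
next
  case (Suc n)
  let ?e = "Echeck ^ Suc n" and ?l = "lin_Kinv2 (1 / q ^ (3 * n)) (- 1 / q ^ n)"
  have "F * Echeck ^ Suc (Suc n) = (1 / q ^ 2) \<odot> (Echeck * (F * ?e)) + h * ?e"
    by (simp only: power_Suc[of Echeck "Suc n"] mult.assoc[symmetric] F_Echeck distrib_right scaleU_simps)
  also have "Echeck * (F * ?e) = (1 / q ^ (2 * Suc n)) \<odot> (Echeck ^ Suc (Suc n) * F)
       + (qint (int (Suc n)) / (q ^ 2 - 1)) \<odot> (?e * ?l)"
    by (simp only: Suc) (simp add: distrib_left scaleU_simps mult.assoc)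
  also have "h * ?e = ?e * lin_Kinv2 (1 / (q ^ 2 - 1) / q ^ (4 * Suc n)) (- 1 / (q ^ 2 - 1))"
    unfolding h_eq_lin_Kinv2 by (rule lin_Kinv2_Echeck_power)
  finally have *: "F * Echeck ^ Suc (Suc n) = (1 / q ^ 2 * (1 / q ^ (2 * Suc n))) \<odot> (Echeck ^ Suc (Suc n) * F)
     + ?e * (lin_Kinv2 (1 / q ^ 2 * (qint (int (Suc n)) / (q ^ 2 - 1)) * (1 / q ^ (3 * n)) + 1 / (q ^ 2 - 1) / q ^ (4 * Suc n))
          (1 / q ^ 2 * (qint (int (Suc n)) / (q ^ 2 - 1)) * (- 1 / q ^ n) + - 1 / (q ^ 2 - 1)))"
    by (simp only: lin_Kinv2_add[symmetric] scaleU_lin_Kinv2[symmetric] scaleU_add_right scaleU_simps distrib_left add.assoc)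
  have [simp]: "q\<^sup>2 - 1 \<noteq> 0" "q * q - 1 \<noteq> 0"  using q_square_neq_1 by (simp_all add: power2_eq_square)
  define x where "x = q ^ n"
  have [simp]: "x \<noteq> 0" by (simp add: x_def)
  have int: "q powi (int (Suc n)) = x * q" "q powi (int (Suc (Suc n))) = x * q ^ 2"
     "q powi (-int (Suc n)) = 1 / (x * q)" "q powi (-int (Suc (Suc n))) = 1 / (x * q ^ 2)"
    unfolding power_int_minus power_int_of_nat x_def by (simp_all add: eval_nat_numeral field_simps)
  have nat: "q ^ (3 * n) = x ^ 3" "q ^ (4 * Suc n) = x ^ 4 * q ^ 4" "q ^ (3 * Suc n) = x ^ 3 * q ^ 3"
     "q ^ Suc n = x * q"
    unfolding x_def by (simp_all add: power_mult[symmetric] mult.commute power_add[symmetric])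
  have qi: "q - inverse q = (q ^ 2 - 1) / q"
    by (simp add: field_simps power2_eq_square)
  have 1: "1 / q ^ 2 * (qint (int (Suc n)) / (q ^ 2 - 1)) * (1 / q ^ (3 * n)) + 1 / (q ^ 2 - 1) / q ^ (4 * Suc n)
     = qint (int (Suc (Suc n))) / (q ^ 2 - 1) * (1 / q ^ (3 * Suc n))"
    unfolding qint_def int nat x_def[symmetric] qi
    by (simp add: divide_simps) (simp add: algebra_simps eval_nat_numeral)
  have 2: "1 / q ^ 2 * (qint (int (Suc n)) / (q ^ 2 - 1)) * (- 1 / q ^ n) + - 1 / (q ^ 2 - 1)
     = qint (int (Suc (Suc n))) / (q ^ 2 - 1) * (- 1 / q ^ Suc n)"
    unfolding qint_def int nat x_def[symmetric] qi
    by (simp add: divide_simps) (simp add: algebra_simps eval_nat_numeral)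
  have 3: "1 / q ^ 2 * (1 / q ^ (2 * Suc n)) = 1 / q ^ (2 * Suc (Suc n))"
    by (simp add: power_add[symmetric])
  show ?case
    unfolding * 1 2 3 by (simp only: scaleU_lin_Kinv2[symmetric] scaleU_mult_right)
qed

lemma Echeck_dp_Suc: "Echeck * Echeck_dp n = qint (int (Suc n)) \<odot> Echeck_dp (Suc n)"
  using qint_nonzero[of "Suc n"]
  by (simp add: Echeck_dp_def qfact_Suc scaleU_simps del: of_nat_Suc)

lemma F_dp_Suc: "F * F_dp n = qint (int (Suc n)) \<odot> F_dp (Suc n)"
  using qint_nonzero[of "Suc n"]
  by (simp add: F_dp_def qfact_Suc scaleU_simps del: of_nat_Suc)

text \<open>What remains between \<open>Echeck_dp n\<close> and the right-hand factors when \<open>F\<close> passes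
  \<open>Echeck_dp (Suc n)\<close>. It has no quantum integer in it: the one in the commutator with
  \<open>Echeck ^ Suc n\<close> cancels against the denominators of the divided powers.\<close>

definition commutator_coeff :: "nat \<Rightarrow> U" where
  "commutator_coeff n = (1 / (q ^ 2 - 1)) \<odot> lin_Kinv2 (1 / q ^ (3 * n)) (- 1 / q ^ n)"

lemma F_Echeck_dp:
  "F * Echeck_dp n = (1 / q ^ (2 * n)) \<odot> (Echeck_dp n * F)
     + (if n = 0 then 0 else Echeck_dp (n - 1) * commutator_coeff (n - 1))"
proof (cases n)
  case 0
  then show ?thesis by (simp add: Echeck_dp_def qfact_def scaleU_simps)
next
  case (Suc k)
  have "F * Echeck_dp (Suc k) = (1 / qfact (Suc k)) \<odot> (F * Echeck ^ Suc k)"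
    by (simp only: Echeck_dp_def scaleU_simps)
  also have "\<dots> = (1 / q ^ (2 * Suc k)) \<odot> (Echeck_dp (Suc k) * F)
     + (1 / qfact (Suc k) * qint (int (Suc k))) \<odot> (Echeck ^ k * commutator_coeff k)"
    unfolding F_Echeck_power commutator_coeff_def Echeck_dp_def
    by (simp add: scaleU_simps scaleU_add_right mult.commute)
  also have "1 / qfact (Suc k) * qint (int (Suc k)) = 1 / qfact k"
    using qint_nonzero[of "Suc k"] by (simp add: qfact_Suc del: of_nat_Suc)
  finally show ?thesis by (simp add: Suc Echeck_dp_def scaleU_simps)
qed

section \<open>Brackets\<close>

lemma hbinom_0: "hbinom r 0 = 1"
  by (simp add: hbinom_def)

lemma hbinom_Suc:
  "hbinom r (Suc c) = hbinom r c *
     ((1 / (q ^ (4 * Suc c) - 1)) \<odot> lin_Kinv2 (q powi (4 * (r + int c))) (- 1))"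
proof -
  have "[1..int (Suc c)] = [1..int c] @ [int (Suc c)]"
    using upto_rec2[of 1 "int (Suc c)"] by simp
  moreover have "q powi (4 * int (Suc c)) = q ^ (4 * Suc c)"
    by (metis of_nat_mult of_nat_numeral power_int_of_nat)
  ultimately show ?thesis
    by (simp add: hbinom_def lin_Kinv2_def scaleU_minus_left scaleU_one algebra_simps)
qed

text \<open>Lowering the parameter \<open>r\<close> by one shifts the numerators of the bracket by one place, so
  \<open>hbinom (r - 1) (Suc c)\<close> and \<open>hbinom r (Suc c)\<close> have all numerators but one in common.
  Together with \<open>hbinom_Suc\<close> this exhibits both as \<open>hbinom r c\<close> times a
  polynomial of degree one in \<open>Kinv ^ 2\<close>.\<close>

lemma hbinom_shift_Suc:
  "hbinom (r - 1) (Suc c) = hbinom r c *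
     ((1 / (q ^ (4 * Suc c) - 1)) \<odot> lin_Kinv2 (q powi (4 * (r - 1))) (- 1))"
proof (induction c)
  case 0
  show ?case by (simp add: hbinom_Suc hbinom_0)
next
  case (Suc c)
  have "hbinom (r - 1) (Suc (Suc c)) = hbinom r c *
     ((1 / (q ^ (4 * Suc c) - 1)) \<odot> lin_Kinv2 (q powi (4 * (r - 1))) (- 1)) *
     ((1 / (q ^ (4 * Suc (Suc c)) - 1)) \<odot> lin_Kinv2 (q powi (4 * (r + int c))) (- 1))"
    unfolding hbinom_Suc[of "r - 1" "Suc c"] Suc by simp
  also have "\<dots> = hbinom r (Suc c) *
     ((1 / (q ^ (4 * Suc (Suc c)) - 1)) \<odot> lin_Kinv2 (q powi (4 * (r - 1))) (- 1))"
    unfolding hbinom_Suc[of r c]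
    by (simp only: scaleU_simps mult.assoc lin_Kinv2_commute[of "q powi (4 * (r - 1))"])
  finally show ?case .
qed

text \<open>Commuting \<open>F\<close> past \<open>Kinv ^ 2\<close> divides it by \<open>q ^ 4\<close>, and this is the effect of
  lowering the parameter of the bracket by one.\<close>

lemma F_hbinom: "F * hbinom r c = hbinom (r - 1) c * F"
proof (induction c)
  case 0
  show ?case by (simp add: hbinom_0)
next
  case (Suc c)
  have "q powi (4 * (r + int c)) / q ^ 4 = q powi (4 * (r - 1 + int c))"
    using power_int_diff[of q "4 * (r + int c)" 4] by (simp add: algebra_simps)
  then show ?case
    by (simp add: hbinom_Suc mult.assoc[symmetric] Suc scaleU_simps)
       (simp add: mult.assoc F_lin_Kinv2)
qed

section \<open>Ordered sums and multiplication by \<open>t\<close>\<close>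

text \<open>The exponents \<open>(a, b, c)\<close> of \<open>Echeck\<close>, of \<open>F\<close> and of the bracket in degree \<open>n\<close>, where the
  bracket counts twice. The symmetric description makes the index shifts caused by
  multiplication with \<open>t\<close> plain bijections.\<close>

definition triples :: "nat \<Rightarrow> (nat \<times> nat \<times> nat) set" where
  "triples n = {(a, b, c). a + b + 2 * c = n}"

lemma finite_triples: "finite (triples n)"
  by (rule finite_subset[of _ "{..n} \<times> {..n} \<times> {..n}"]) (auto simp: triples_def)

lemma sum_triples_shift_fst:
  fixes f :: "nat \<Rightarrow> nat \<Rightarrow> nat \<Rightarrow> U"
  assumes "\<And>b c. f 0 b c = 0"
  shows "(\<Sum>(a, b, c)\<in>triples n. f (Suc a) b c) = (\<Sum>(a, b, c)\<in>triples (Suc n). f a b c)"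
  by (rule sum.reindex_bij_witness_not_neutral[where S' = "{}" and T' = "{0} \<times> UNIV \<inter> triples (Suc n)"
      and i = "\<lambda>(a, b, c). (a - 1, b, c)" and j = "\<lambda>(a, b, c). (Suc a, b, c)"])
     (auto simp: triples_def assms intro: finite_subset[OF _ finite_triples[of "Suc n"]])

lemma sum_triples_shift_snd:
  fixes f :: "nat \<Rightarrow> nat \<Rightarrow> nat \<Rightarrow> U"
  assumes "\<And>a c. f a 0 c = 0"
  shows "(\<Sum>(a, b, c)\<in>triples n. f a (Suc b) c) = (\<Sum>(a, b, c)\<in>triples (Suc n). f a b c)"
  by (rule sum.reindex_bij_witness_not_neutral[where S' = "{}" and T' = "(UNIV \<times> {0} \<times> UNIV) \<inter> triples (Suc n)"
      and i = "\<lambda>(a, b, c). (a, b - 1, c)" and j = "\<lambda>(a, b, c). (a, Suc b, c)"])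
     (auto simp: triples_def assms intro: finite_subset[OF _ finite_triples[of "Suc n"]])

lemma sum_triples_shift_trd:
  fixes f :: "nat \<Rightarrow> nat \<Rightarrow> nat \<Rightarrow> U"
  assumes "\<And>a b. f a b 0 = 0"
  shows "(\<Sum>(a, b, c)\<in>triples n. f a b (Suc c)) = (\<Sum>(a, b, c)\<in>triples (Suc (Suc n)). f a b c)"
  by (rule sum.reindex_bij_witness_not_neutral[where S' = "{}" and T' = "(UNIV \<times> UNIV \<times> {0}) \<inter> triples (Suc (Suc n))"
      and i = "\<lambda>(a, b, c). (a, b, c - 1)" and j = "\<lambda>(a, b, c). (a, b, Suc c)"])
     (auto simp: triples_def assms intro: finite_subset[OF _ finite_triples[of "Suc (Suc n)"]])

text \<open>When \<open>F\<close> is absorbed by \<open>Echeck_dp a\<close>, the exponent \<open>a\<close> drops by one, and a new factor of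
  degree one in \<open>Kinv ^ 2\<close> appears: the degree grows by one in total.\<close>

lemma sum_triples_fst_to_trd:
  fixes f :: "nat \<Rightarrow> nat \<Rightarrow> nat \<Rightarrow> U"
  assumes "\<And>a b. f a b 0 = 0"
  shows "(\<Sum>(a, b, c)\<in>triples n. if a = 0 then 0 else f (a - 1) b (Suc c))
    = (\<Sum>(a, b, c)\<in>triples (Suc n). f a b c)"
  \<comment> \<open>The triples with \<open>a = 0\<close> have no partner; they are sent to points with last entry \<open>0\<close>,
    where \<open>f\<close> vanishes.\<close>
  by (rule sum.reindex_bij_witness_not_neutral[where S' = "{0} \<times> UNIV \<inter> triples n"
      and T' = "(UNIV \<times> UNIV \<times> {0}) \<inter> triples (Suc n)"
      and i = "\<lambda>(a, b, c). (Suc a, b, c - 1)" and j = "\<lambda>(a, b, c). (a - 1, b, if a = 0 then 0 else Suc c)"])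
     (auto simp: triples_def assms split: if_splits intro: finite_subset[OF _ finite_triples[of n]]
         finite_subset[OF _ finite_triples[of "Suc n"]])

lemma qint_0 [simp]: "qint 0 = 0"
  by (simp add: qint_def)

text \<open>The parity \<open>p\<close> is \<open>0\<close> for even and \<open>1\<close> for odd degree. The arguments are integers because
  the shifted weights below are also formed where a shifted exponent is \<open>-1\<close>; there a
  vanishing quantum integer or the case distinction on \<open>c\<close> removes them.\<close>

definition weight :: "int \<Rightarrow> int \<Rightarrow> int \<Rightarrow> int \<Rightarrow> Qq" where
  "weight p a b c = q powi (binom2 (2 * c + p) - a * b)"

definition ordered_sum :: "int \<Rightarrow> int \<Rightarrow> nat \<Rightarrow> U" where
  "ordered_sum p r n = (\<Sum>(a, b, c)\<in>triples n.
     weight p (int a) (int b) (int c) \<odot> (Echeck_dp a * hbinom r c * F_dp b))"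

text \<open>One summand per way of placing the new factor: \<open>Echeck\<close> joins the left power, \<open>F\<close> travels
  to the right power, or \<open>F\<close> is absorbed by the left power.\<close>

lemma t_mult_monomial:
  "t * (Echeck_dp a * hbinom r c * F_dp b) =
     qint (int (Suc a)) \<odot> (Echeck_dp (Suc a) * hbinom r c * F_dp b)
   + (qint (int (Suc b)) / q ^ (2 * a)) \<odot> (Echeck_dp a * hbinom (r - 1) c * F_dp (Suc b))
   + (if a = 0 then 0
      else Echeck_dp (a - 1) * (hbinom r c * commutator_coeff (a - 1)) * F_dp b)"
proof -
  have comm: "lin_Kinv2 x y * hbinom r c = hbinom r c * lin_Kinv2 x y" for x y
  proof (induction c)
    case (Suc c)
    then show ?case
      by (simp add: hbinom_Suc scaleU_simps mult.assoc[symmetric])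
         (simp add: mult.assoc lin_Kinv2_commute[of x y])
  qed (simp add: hbinom_0)
  have "F * (Echeck_dp a * hbinom r c * F_dp b) =
     (1 / q ^ (2 * a)) \<odot> (Echeck_dp a * (F * hbinom r c) * F_dp b)
   + (if a = 0 then 0
      else Echeck_dp (a - 1) * (commutator_coeff (a - 1) * hbinom r c) * F_dp b)"
    by (simp add: mult.assoc[symmetric] F_Echeck_dp distrib_right scaleU_simps)
  also have "Echeck_dp a * (F * hbinom r c) * F_dp b =
      qint (int (Suc b)) \<odot> (Echeck_dp a * hbinom (r - 1) c * F_dp (Suc b))"
    by (simp only: F_hbinom mult.assoc F_dp_Suc scaleU_simps)
  finally show ?thesis
    by (simp add: t_def distrib_right mult.assoc[symmetric] Echeck_dp_Suc scaleU_simps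
        commutator_coeff_def comm del: of_nat_Suc)
qed

text \<open>The coefficient of \<open>Echeck_dp a\<close> and \<open>F_dp b\<close> in \<open>t * ordered_sum p r n\<close> that belongs to \<open>c\<close>,
  the three terms of \<open>t_mult_monomial\<close> being collected after the index shifts.\<close>

definition next_coeff :: "int \<Rightarrow> int \<Rightarrow> nat \<Rightarrow> nat \<Rightarrow> nat \<Rightarrow> U" where
  "next_coeff p r a b c =
     (qint (int a) * weight p (int a - 1) (int b) (int c)) \<odot> hbinom r c
     + (qint (int b) / q ^ (2 * a) * weight p (int a) (int b - 1) (int c)) \<odot> hbinom (r - 1) c
     + (if c = 0 then 0
        else weight p (int a + 1) (int b) (int c - 1) \<odot> (hbinom r (c - 1) * commutator_coeff a))"

lemma t_mult_ordered_sum: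
  "t * ordered_sum p r n =
     (\<Sum>(a, b, c)\<in>triples (Suc n). Echeck_dp a * next_coeff p r a b c * F_dp b)"
proof -
  let ?f = "\<lambda>a b c. (qint (int a) * weight p (int a - 1) (int b) (int c)) \<odot>
        (Echeck_dp a * hbinom r c * F_dp b)"
  let ?g = "\<lambda>a b c. (qint (int b) / q ^ (2 * a) * weight p (int a) (int b - 1) (int c)) \<odot>
        (Echeck_dp a * hbinom (r - 1) c * F_dp b)"
  let ?h = "\<lambda>a b c. if c = 0 then 0 else weight p (int a + 1) (int b) (int c - 1) \<odot>
        (Echeck_dp a * (hbinom r (c - 1) * commutator_coeff a) * F_dp b)"
  have "t * ordered_sum p r n = (\<Sum>(a, b, c)\<in>triples n. ?f (Suc a) b c + ?g a (Suc b) c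
      + (if a = 0 then 0 else ?h (a - 1) b (Suc c)))"
    unfolding ordered_sum_def sum_distrib_left
  proof (intro sum.cong refl, clarify)
    fix a b c
    show "t * (weight p (int a) (int b) (int c) \<odot> (Echeck_dp a * hbinom r c * F_dp b)) =
       ?f (Suc a) b c + ?g a (Suc b) c + (if a = 0 then 0 else ?h (a - 1) b (Suc c))"
      unfolding scaleU_mult_right t_mult_monomial
      by (simp add: scaleU_add_right scaleU_scaleU mult.commute)
  qed
  also have "\<dots> = (\<Sum>(a, b, c)\<in>triples n. ?f (Suc a) b c) + (\<Sum>(a, b, c)\<in>triples n. ?g a (Suc b) c)
      + (\<Sum>(a, b, c)\<in>triples n. if a = 0 then 0 else ?h (a - 1) b (Suc c))"
    by (simp only: sum.distrib[symmetric] case_prod_unfold)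
  also have "\<dots> = (\<Sum>(a, b, c)\<in>triples (Suc n). ?f a b c) + (\<Sum>(a, b, c)\<in>triples (Suc n). ?g a b c)
      + (\<Sum>(a, b, c)\<in>triples (Suc n). ?h a b c)"
    by (intro arg_cong2[of _ _ _ _ "(+)"] sum_triples_shift_fst[of ?f] sum_triples_shift_snd[of ?g]
        sum_triples_fst_to_trd[of ?h]) simp_all
  also have "\<dots> = (\<Sum>(a, b, c)\<in>triples (Suc n). ?f a b c + ?g a b c + ?h a b c)"
    by (simp only: sum.distrib[symmetric] case_prod_unfold)
  finally show ?thesis
    by (simp add: next_coeff_def distrib_left distrib_right scaleU_simps if_distrib[of "\<lambda>x. _ * x"]
         if_distrib[of "\<lambda>x. x * _"] mult.assoc cong: if_cong)
qed

section \<open>Recursion for the divided powers of \<open>t\<close>\<close>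

lemma t_ev_1: "t_ev 1 = t"
  using q_minus_inverse_q_nonzero by (simp add: t_ev_def qfact_def qint_def scaleU_simps)

lemma t_mult_t_ev_odd:
  assumes "m \<ge> 1"
  shows "t * t_ev (2 * m - 1) = qint (int (2 * m)) \<odot> t_ev (2 * m)"
proof -
  obtain k where m: "m = Suc k" using assms by (cases m) auto
  have d: "(2 * m - 1) div 2 = k" "odd (2 * m - 1)" "2 * m = Suc (2 * m - 1)" using m by auto
  have "qint (int (2 * m)) / qfact (2 * m) = 1 / qfact (2 * m - 1)"
    using qint_nonzero[of "2 * m"] d(3) qfact_Suc[of "2 * m - 1"] by auto
  then show ?thesis using d m
    by (simp add: t_ev_def scaleU_simps Let_def)
qed

text \<open>The outermost factors of the product for \<open>2 * m + 1\<close> multiply to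
  \<open>t\<^sup>2 - [2m]\<^sup>2\<close>, since \<open>[-n] = -[n]\<close>. The term \<open>t\<^sup>2\<close> gives the left-hand side, and
  \<open>[2m]\<^sup>2\<close> the last summand.\<close>

lemma t_mult_t_ev_even:
  assumes "m \<ge> 1"
  shows "t * t_ev (2 * m) = qint (int (2 * m + 1)) \<odot> t_ev (2 * m + 1)
           + qint (int (2 * m)) \<odot> t_ev (2 * m - 1)"
proof -
  obtain k where m: "m = Suc k" using assms by (cases m) auto
  let ?P = "\<lambda>n. \<Prod>i\<leftarrow>[- int n..int n]. t - qint (2 * i) \<odot> 1"
  let ?x = "qint (int (2 * m))"
  have d: "(2 * m - 1) div 2 = k" "odd (2 * m - 1)" "2 * m = Suc (2 * m - 1)" using m by auto
  have c: "t * ?P n = ?P n * t" for n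
  proof -
    have "t * (\<Prod>i\<leftarrow>xs. t - qint (2 * i) \<odot> 1) = (\<Prod>i\<leftarrow>xs. t - qint (2 * i) \<odot> 1) * t" for xs
    proof (induction xs)
      case (Cons i xs)
      have "t * (t - qint (2 * i) \<odot> 1) = (t - qint (2 * i) \<odot> 1) * t"
        by (simp add: algebra_simps scaleU_simps)
      then show ?case using Cons by simp (metis mult.assoc)
    qed simp
    then show ?thesis .
  qed
  have neg: "qint (- i) = - qint i" for i by (simp add: qint_def minus_divide_left)
  have l: "[- int m..int m] = (- int m) # [- int k..int k] @ [int m]"
    using upto_rec1[of "- int m" "int m"] upto_rec2[of "- int m + 1" "int m"] m by simp
  have "?P m = (t + ?x \<odot> 1) * ?P k * (t - ?x \<odot> 1)"
    unfolding l by (simp add: mult.assoc neg scaleU_minus_left)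
  also have "\<dots> = t * (?P k * t) - (?x * ?x) \<odot> ?P k + ?x \<odot> (?P k * t - t * ?P k)"
    by (simp add: distrib_left distrib_right left_diff_distrib right_diff_distrib mult.assoc
         scaleU_simps scaleU_diff_right scaleU_add_right del: of_nat_mult)
  also have "\<dots> = t * (t * ?P k) - (?x * ?x) \<odot> ?P k"
    by (simp add: c)
  finally have P: "t * (t * ?P k) = ?P m + (?x * ?x) \<odot> ?P k" by simp
  have 1: "t_ev (2 * m + 1) = (1 / qfact (2 * m + 1)) \<odot> ?P m" by (simp add: t_ev_def Let_def)
  have 2: "t_ev (2 * m - 1) = (1 / qfact (2 * m - 1)) \<odot> ?P k" using d m by (simp add: t_ev_def Let_def)
  have 3: "t_ev (2 * m) = (1 / qfact (2 * m)) \<odot> (t * ?P k)" using m by (simp add: t_ev_def Let_def)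
  have 4: "qint (int (2 * m + 1)) * (1 / qfact (2 * m + 1)) = 1 / qfact (2 * m)"
    using qint_nonzero[of "2 * m + 1"] qfact_Suc[of "2 * m"] by auto
  have 5: "qint (int (2 * m)) * (1 / qfact (2 * m - 1)) = 1 / qfact (2 * m) * (?x * ?x)"
    using qint_nonzero[of "2 * m"] d(3) qfact_Suc[of "2 * m - 1"] m by auto
  show ?thesis unfolding 1 2 3 scaleU_mult_right scaleU_scaleU 4 5 P scaleU_add_right ..
qed

section \<open>Recursion for the coefficients\<close>

lemma binom2_even: "binom2 (2 * c) = c * (2 * c - 1)"
  by (simp add: binom2_def)

lemma binom2_odd: "binom2 (2 * c + 1) = c * (2 * c + 1)"
  by (simp add: binom2_def algebra_simps)

lemma q_powi_mult_nat: "q powi (int k * a) = (q powi a) ^ k"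
  by (simp add: power_int_mult mult.commute)

text \<open>All weights that occur in \<open>next_coeff\<close> and in its expected value have exponents with the same
  quadratic part \<open>2 * c * c - a * b\<close>. They are therefore multiples of \<open>weight 0 a b c\<close> by Laurent
  monomials in \<open>q\<close> and in the powers of \<open>q\<close> with exponents \<open>a\<close>, \<open>b\<close>, \<open>c\<close>.\<close>

lemma weight_rules:
  "weight 1 (a - 1) b c = weight 0 a b c * q powi b * (q powi c) ^ 2"
  "weight 1 a (b - 1) c = weight 0 a b c * q powi a * (q powi c) ^ 2"
  "weight 1 (a + 1) b (c - 1) = weight 0 a b c * q / ((q powi c) ^ 2 * q powi b)"
  "weight 0 (a - 1) b c = weight 0 a b c * q powi b"
  "weight 0 a (b - 1) c = weight 0 a b c * q powi a"
  "weight 0 (a + 1) b (c - 1) = weight 0 a b c * q ^ 3 / ((q powi c) ^ 4 * q powi b)"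
  "weight 1 a b c = weight 0 a b c * (q powi c) ^ 2"
  "weight 1 a b (c - 1) = weight 0 a b c * q / (q powi c) ^ 2"
proof -
  have *: "q powi x * q powi y = q powi (x + y)" "q powi x / q powi y = q powi (x - y)"
     "(q powi x) ^ k = q powi (int k * x)" "q ^ k = q powi (int k)" for x y k
    by (simp_all add: power_int_add power_int_diff q_powi_mult_nat)
  have q: "q = q powi 1" by simp
  note d = weight_def binom2_even binom2_odd add_0_right
  show "weight 1 (a - 1) b c = weight 0 a b c * q powi b * (q powi c) ^ 2"
    "weight 1 a (b - 1) c = weight 0 a b c * q powi a * (q powi c) ^ 2"
    "weight 0 (a - 1) b c = weight 0 a b c * q powi b"
    "weight 0 a (b - 1) c = weight 0 a b c * q powi a"
    "weight 0 (a + 1) b (c - 1) = weight 0 a b c * q ^ 3 / ((q powi c) ^ 4 * q powi b)"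
    "weight 1 a b c = weight 0 a b c * (q powi c) ^ 2"
    unfolding d * by (simp_all add: algebra_simps)
  show "weight 1 (a + 1) b (c - 1) = weight 0 a b c * q / ((q powi c) ^ 2 * q powi b)"
    "weight 1 a b (c - 1) = weight 0 a b c * q / (q powi c) ^ 2"
    unfolding d by (subst (3) q, unfold *, simp add: algebra_simps)+
qed

lemma q_square_minus_1_nonzero: "q ^ 2 - 1 \<noteq> 0"
  using q_square_neq_1 by simp

lemma qint_eq: "qint n = q * ((q powi n) ^ 2 - 1) / ((q ^ 2 - 1) * q powi n)"
proof -
  have "q - inverse q = (q ^ 2 - 1) / q"
    by (simp add: field_simps power2_eq_square)
  then show ?thesis
    by (simp add: qint_def power_int_minus field_simps power2_eq_square)
qed

text \<open>The scalar identities behind the recursion. After the common factor \<open>hbinom r (c - 1)\<close> and the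
  common weight are removed, comparing the coefficients of \<open>Kinv ^ 2\<close> and of \<open>1\<close> gives two
  identities for each parity. They are stated for indeterminates, to be read as \<open>p = q\<close>,
  \<open>X = q ^ a\<close>, \<open>Y = q ^ b\<close>, \<open>Z = q ^ c\<close>, \<open>k = q\<^sup>2 - 1\<close>, \<open>D = q ^ (4 * c) - 1\<close>. In either parity the
  degree of the product is \<open>a + b + 2 * c\<close>, whose power of \<open>q\<close> is \<open>X * Y * Z\<^sup>2\<close>. The denominator \<open>D\<close>
  is kept as a variable of its own, since clearing denominators only requires \<open>D \<noteq> 0\<close>.\<close>

lemma odd_to_even_coefficient_Kinv_square:
  fixes X Y Z D k p :: "'a::field"
  assumes "X \<noteq> 0" "Y \<noteq> 0" "Z \<noteq> 0" "k \<noteq> 0" "D \<noteq> 0" and Z: "Z ^ 4 = D + 1"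
  shows "p * (X\<^sup>2 - 1) / (k * X) * (Y * Z\<^sup>2) * (1 / D * (1 / (X * Y) ^ 2))
     + p * (Y\<^sup>2 - 1) / (k * Y) / X\<^sup>2 * (X * Z\<^sup>2) * (1 / D * (1 / (X * Y * Z\<^sup>2) ^ 2))
     + p / (Z\<^sup>2 * Y) * (1 / k * (1 / X ^ 3))
   = p * ((X * Y * Z\<^sup>2)\<^sup>2 - 1) / (k * (X * Y * Z\<^sup>2)) * (1 / D * (1 / (X * Y) ^ 2))"
proof -
  have D: "D = Z ^ 4 - 1" using Z by simp
  show ?thesis using assms(1-5)
    by (simp add: divide_simps) (simp add: D algebra_simps eval_nat_numeral)
qed

lemma odd_to_even_coefficient_constant:
  fixes X Y Z D k p :: "'a::field"
  assumes "X \<noteq> 0" "Y \<noteq> 0" "Z \<noteq> 0" "k \<noteq> 0" "D \<noteq> 0" and Z: "Z ^ 4 = D + 1"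
  shows "p * (X\<^sup>2 - 1) / (k * X) * (Y * Z\<^sup>2) * (1 / D)
     + p * (Y\<^sup>2 - 1) / (k * Y) / X\<^sup>2 * (X * Z\<^sup>2) * (1 / D)
     + p / (Z\<^sup>2 * Y) * (1 / k * (1 / X))
   = p * ((X * Y * Z\<^sup>2)\<^sup>2 - 1) / (k * (X * Y * Z\<^sup>2)) * (1 / D)"
proof -
  have D: "D = Z ^ 4 - 1" using Z by simp
  show ?thesis using assms(1-5)
    by (simp add: divide_simps) (simp add: D algebra_simps eval_nat_numeral)
qed

lemma even_to_odd_coefficient_Kinv_square:
  fixes X Y Z D k p :: "'a::field"
  assumes "X \<noteq> 0" "Y \<noteq> 0" "Z \<noteq> 0" "k \<noteq> 0" "p \<noteq> 0" "D \<noteq> 0" and Z: "Z ^ 4 = D + 1"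
  shows "p * (X\<^sup>2 - 1) / (k * X) * Y * (1 / D * (p / (X * Y)) ^ 2)
     + p * (Y\<^sup>2 - 1) / (k * Y) / X\<^sup>2 * X * (1 / D * (p / (X * Y * Z\<^sup>2)) ^ 2)
     + p ^ 3 / (Z ^ 4 * Y) * (1 / k * (1 / X ^ 3))
   = p * ((X * Y * Z\<^sup>2)\<^sup>2 - 1) / (k * (X * Y * Z\<^sup>2)) * Z\<^sup>2 * (1 / D * (p / (X * Y * Z\<^sup>2)) ^ 2)"
proof -
  have D: "D = Z ^ 4 - 1" using Z by simp
  show ?thesis using assms(1-6)
    by (simp add: divide_simps) (simp add: D algebra_simps eval_nat_numeral)
qed

lemma even_to_odd_coefficient_constant:
  fixes X Y Z D k p :: "'a::field"
  assumes "X \<noteq> 0" "Y \<noteq> 0" "Z \<noteq> 0" "k \<noteq> 0" "p \<noteq> 0" "D \<noteq> 0" and Z: "Z ^ 4 = D + 1"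
  shows "p * (X\<^sup>2 - 1) / (k * X) * Y * (1 / D)
     + p * (Y\<^sup>2 - 1) / (k * Y) / X\<^sup>2 * X * (1 / D)
     + p ^ 3 / (Z ^ 4 * Y) * (1 / k * (1 / X))
   = p * ((X * Y * Z\<^sup>2)\<^sup>2 - 1) / (k * (X * Y * Z\<^sup>2)) * Z\<^sup>2 * (1 / D)
     - p * ((X * Y * Z\<^sup>2 / p)\<^sup>2 - 1) / (k * (X * Y * Z\<^sup>2 / p)) * (p / Z\<^sup>2)"
proof -
  have D: "D = Z ^ 4 - 1" using Z by simp
  show ?thesis using assms(1-6)
    by (simp add: divide_simps) (simp add: D algebra_simps eval_nat_numeral)
qed

lemma combine_affine_multiples:
  "(\<alpha> * w) \<odot> (H * (d \<odot> lin_Kinv2 P (- 1))) + (\<beta> * w) \<odot> (H * (d \<odot> lin_Kinv2 P' (- 1)))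
     + (\<gamma> * w) \<odot> (H * (k \<odot> lin_Kinv2 u (- v)))
   = w \<odot> (H * lin_Kinv2 (\<alpha> * (d * P) + \<beta> * (d * P') + \<gamma> * (k * u))
                           (- (\<alpha> * d + \<beta> * d + \<gamma> * (k * v))))"
proof -
  have "(x * w) \<odot> (H * (y \<odot> lin_Kinv2 a b)) = w \<odot> (H * lin_Kinv2 (x * (y * a)) (x * (y * b)))" for x y a b
    by (simp only: scaleU_lin_Kinv2[symmetric] scaleU_simps mult.assoc) (simp add: mult_ac)
  then show ?thesis
    by (simp add: scaleU_add_right[symmetric] distrib_left[symmetric] lin_Kinv2_add)
qed

text \<open>For \<open>c > 0\<close> all terms are multiples of \<open>hbinom (1 - m) (c - 1)\<close> by polynomials of degree one, and
  the claim is the pair of identities \<open>odd_to_even_coefficient_Kinv_square\<close> and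
  \<open>odd_to_even_coefficient_constant\<close>; for \<open>c = 0\<close> it is
  \<open>q\<^sup>b [a] + q\<^sup>-\<^sup>a [b] = [a + b]\<close>.\<close>

lemma next_coeff_odd_to_even:
  fixes a b c m :: nat
  assumes m: "a + b + 2 * c = 2 * m"
  shows "next_coeff 1 (1 - int m) a b c
     = (qint (int (2 * m)) * weight 0 (int a) (int b) (int c)) \<odot> hbinom (1 - int m) c"
proof -
  define X Y Z w where "X = q ^ a" "Y = q ^ b" "Z = q ^ c" "w = weight 0 (int a) (int b) (int c)"
  have nz: "X \<noteq> 0" "Y \<noteq> 0" "Z \<noteq> 0" "q ^ 2 - 1 \<noteq> 0"
    using q_square_minus_1_nonzero by (simp_all add: X_Y_Z_w_def)
  have pow: "q ^ (2 * a) = X ^ 2" "q ^ (3 * a) = X ^ 3" "q ^ (4 * c) = Z ^ 4" "q ^ (2 * m) = X * Y * Z ^ 2"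
    unfolding m[symmetric] by (simp_all add: X_Y_Z_w_def power_mult[symmetric] power_add mult.commute)
  have pw: "q powi int a = X" "q powi int b = Y" "q powi int c = Z"
      "q powi (int (2 * m)) = X * Y * Z ^ 2"
    using pow(4) by (simp_all only: power_int_of_nat X_Y_Z_w_def)
  note W = weight_rules[of "int a" "int b" "int c", folded X_Y_Z_w_def, unfolded pw X_Y_Z_w_def(4)[symmetric]]
  note Q = qint_eq[of "int a"] qint_eq[of "int b"] qint_eq[of "int (2 * m)"]
  show ?thesis
  proof (cases c)
    case 0
    then have [simp]: "Z = 1" by (simp add: X_Y_Z_w_def)
    have "qint (int a) * (w * Y * Z ^ 2) + qint (int b) / X ^ 2 * (w * X * Z ^ 2) = qint (int (2 * m)) * w"
      unfolding Q pw using nz by (simp add: divide_simps) (simp add: algebra_simps eval_nat_numeral)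
    then show ?thesis
      using 0 unfolding next_coeff_def W pow by (simp add: hbinom_0 X_Y_Z_w_def scaleU_add_left[symmetric])
  next
    case (Suc d)
    define D where "D = Z ^ 4 - 1"
    have D: "D \<noteq> 0" "Z ^ 4 = D + 1"
      using q_power_neq_1[of "4 * c"] Suc unfolding D_def pow(3)[symmetric] by simp_all
    let ?H = "hbinom (1 - int m) d"
    \<comment> \<open>\<open>m\<close> enters through \<open>4 * m = 2 * (a + b + 2 * c)\<close>: the last factor of the bracket has the
      exponent \<open>4 * c - 4 * m = - 2 * (a + b)\<close>.\<close>
    have "4 * (1 - int m + int d) = - int (2 * (a + b))" "4 * (1 - int m - 1) = - int (2 * (2 * m))"
      using m Suc by simp_all
    then have P: "q powi (4 * (1 - int m + int d)) = 1 / (X * Y) ^ 2"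
        "q powi (4 * (1 - int m - 1)) = 1 / (X * Y * Z\<^sup>2) ^ 2"
      unfolding pow(4)[symmetric] unfolding X_Y_Z_w_def
      by (simp_all only: power_int_minus power_int_of_nat)
         (simp_all add: power_mult[symmetric] power_add[symmetric] power_mult_distrib[symmetric] inverse_eq_divide mult.commute)
    have H: "hbinom (1 - int m) c = ?H * ((1 / D) \<odot> lin_Kinv2 (1 / (X * Y) ^ 2) (- 1))"
      "hbinom (1 - int m - 1) c = ?H * ((1 / D) \<odot> lin_Kinv2 (1 / (X * Y * Z\<^sup>2) ^ 2) (- 1))"
      using hbinom_Suc[of "1 - int m" d] hbinom_shift_Suc[of "1 - int m" d]
      unfolding Suc[symmetric] pow P D_def by simp_all
    have "next_coeff 1 (1 - int m) a b c =
        (q * (X\<^sup>2 - 1) / ((q\<^sup>2 - 1) * X) * (Y * Z\<^sup>2) * w) \<odot> (?H * ((1 / D) \<odot> lin_Kinv2 (1 / (X * Y) ^ 2) (- 1)))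
      + (q * (Y\<^sup>2 - 1) / ((q\<^sup>2 - 1) * Y) / X\<^sup>2 * (X * Z\<^sup>2) * w) \<odot> (?H * ((1 / D) \<odot> lin_Kinv2 (1 / (X * Y * Z\<^sup>2) ^ 2) (- 1)))
      + (q / (Z\<^sup>2 * Y) * w) \<odot> (?H * ((1 / (q\<^sup>2 - 1)) \<odot> lin_Kinv2 (1 / X ^ 3) (- (1 / X))))"
      unfolding next_coeff_def W H commutator_coeff_def pow Q pw
      using Suc by (simp add: X_Y_Z_w_def(1) mult_ac)
    also have "\<dots> = w \<odot> (?H * ((q * ((X * Y * Z\<^sup>2)\<^sup>2 - 1) / ((q\<^sup>2 - 1) * (X * Y * Z\<^sup>2)) * (1 / D)) \<odot>
         lin_Kinv2 (1 / (X * Y) ^ 2) (- 1)))"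
      unfolding combine_affine_multiples odd_to_even_coefficient_Kinv_square[OF nz D] odd_to_even_coefficient_constant[OF nz D]
      by (simp add: scaleU_lin_Kinv2 mult.assoc)
    also have "\<dots> = (qint (int (2 * m)) * weight 0 (int a) (int b) (int c)) \<odot> hbinom (1 - int m) c"
      unfolding H Q pw X_Y_Z_w_def(4)[symmetric] by (simp add: scaleU_simps mult_ac)
    finally show ?thesis .
  qed
qed

text \<open>The new bracket is \<open>hbinom (- m) c\<close>, which is the bracket that \<open>F\<close> leaves behind when it
  moves to the right. The left-hand side exceeds a scalar multiple of it by a scalar multiple of
  \<open>hbinom (1 - m) (c - 1)\<close>, and this excess is the contribution of \<open>t_ev (2 * m - 1)\<close> to the
  recursion.\<close>

lemma next_coeff_even_to_odd:
  fixes a b c m :: nat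
  assumes m: "a + b + 2 * c = 2 * m + 1"
  shows "next_coeff 0 (1 - int m) a b c
     = (qint (int (2 * m + 1)) * weight 1 (int a) (int b) (int c)) \<odot> hbinom (- int m) c
     + (if c = 0 then 0
        else (qint (int (2 * m)) * weight 1 (int a) (int b) (int c - 1)) \<odot> hbinom (1 - int m) (c - 1))"
proof -
  define X Y Z w where "X = q ^ a" "Y = q ^ b" "Z = q ^ c" "w = weight 0 (int a) (int b) (int c)"
  have nz: "X \<noteq> 0" "Y \<noteq> 0" "Z \<noteq> 0" "q ^ 2 - 1 \<noteq> 0" "q \<noteq> 0"
    using q_square_minus_1_nonzero by (simp_all add: X_Y_Z_w_def)
  have pow: "q ^ (2 * a) = X ^ 2" "q ^ (3 * a) = X ^ 3" "q ^ (4 * c) = Z ^ 4" "q ^ (2 * m + 1) = X * Y * Z ^ 2"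
    unfolding m[symmetric] by (simp_all add: X_Y_Z_w_def power_mult[symmetric] power_add mult.commute)
  have pow': "q ^ (2 * m) = X * Y * Z ^ 2 / q"
    using pow(4) by (simp add: field_simps)
  have pw: "q powi int a = X" "q powi int b = Y" "q powi int c = Z"
      "q powi (int (2 * m + 1)) = X * Y * Z ^ 2" "q powi (int (2 * m)) = X * Y * Z ^ 2 / q"
    using pow(4) pow' by (simp_all only: power_int_of_nat X_Y_Z_w_def)
  note W = weight_rules[of "int a" "int b" "int c", folded X_Y_Z_w_def, unfolded pw X_Y_Z_w_def(4)[symmetric]]
  note Q = qint_eq[of "int a"] qint_eq[of "int b"] qint_eq[of "int (2 * m)"] qint_eq[of "int (2 * m + 1)"]
  show ?thesis
  proof (cases c)
    case 0
    then have [simp]: "Z = 1" by (simp add: X_Y_Z_w_def)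
    have "qint (int a) * (w * Y) + qint (int b) / X ^ 2 * (w * X) = qint (int (2 * m + 1)) * (w * Z ^ 2)"
      unfolding Q pw using nz by (simp add: divide_simps) (simp add: algebra_simps eval_nat_numeral)
    then show ?thesis
      using 0 unfolding next_coeff_def W pow by (simp add: hbinom_0 X_Y_Z_w_def scaleU_add_left[symmetric])
  next
    case (Suc d)
    define D where "D = Z ^ 4 - 1"
    have D: "D \<noteq> 0" "Z ^ 4 = D + 1"
      using q_power_neq_1[of "4 * c"] Suc unfolding D_def pow(3)[symmetric] by simp_all
    let ?H = "hbinom (1 - int m) d"
    let ?B = "q * ((X * Y * Z\<^sup>2)\<^sup>2 - 1) / ((q\<^sup>2 - 1) * (X * Y * Z\<^sup>2)) * Z\<^sup>2"
    let ?C = "q * ((X * Y * Z\<^sup>2 / q)\<^sup>2 - 1) / ((q\<^sup>2 - 1) * (X * Y * Z\<^sup>2 / q)) * (q / Z\<^sup>2)"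
    \<comment> \<open>Now \<open>4 * m = 2 * (a + b + 2 * c) - 2\<close>, so each bracket exponent grows by \<open>2\<close> against the
      other parity.\<close>
    have "4 * (1 - int m + int d) = 2 * (1 - int (a + b))" "4 * (1 - int m - 1) = 2 * - int (2 * m)"
      using m Suc by simp_all
    then have P: "q powi (4 * (1 - int m + int d)) = (q / (X * Y)) ^ 2"
        "q powi (4 * (1 - int m - 1)) = (q / (X * Y * Z\<^sup>2)) ^ 2"
      using q_powi_mult_nat[of 2 "1 - int (a + b)"] q_powi_mult_nat[of 2 "- int (2 * m)"]
      by (simp_all only: of_nat_numeral power_int_minus power_int_of_nat pow')
         (simp_all add: power_int_diff power_int_add X_Y_Z_w_def)
    have H: "hbinom (1 - int m) c = ?H * ((1 / D) \<odot> lin_Kinv2 ((q / (X * Y)) ^ 2) (- 1))"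
      "hbinom (1 - int m - 1) c = ?H * ((1 / D) \<odot> lin_Kinv2 ((q / (X * Y * Z\<^sup>2)) ^ 2) (- 1))"
      using hbinom_Suc[of "1 - int m" d] hbinom_shift_Suc[of "1 - int m" d]
      unfolding Suc[symmetric] pow P D_def by simp_all
    have "next_coeff 0 (1 - int m) a b c =
        (q * (X\<^sup>2 - 1) / ((q\<^sup>2 - 1) * X) * Y * w) \<odot> (?H * ((1 / D) \<odot> lin_Kinv2 ((q / (X * Y)) ^ 2) (- 1)))
      + (q * (Y\<^sup>2 - 1) / ((q\<^sup>2 - 1) * Y) / X\<^sup>2 * X * w) \<odot> (?H * ((1 / D) \<odot> lin_Kinv2 ((q / (X * Y * Z\<^sup>2)) ^ 2) (- 1)))
      + (q ^ 3 / (Z ^ 4 * Y) * w) \<odot> (?H * ((1 / (q\<^sup>2 - 1)) \<odot> lin_Kinv2 (1 / X ^ 3) (- (1 / X))))"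
      unfolding next_coeff_def W H commutator_coeff_def pow Q pw
      using Suc by (simp add: X_Y_Z_w_def(1) mult_ac)
    also have "\<dots> = w \<odot> (?H * lin_Kinv2 (?B * (1 / D * (q / (X * Y * Z\<^sup>2)) ^ 2)) (- (?B * (1 / D) - ?C)))"
      unfolding combine_affine_multiples even_to_odd_coefficient_Kinv_square[OF nz D] even_to_odd_coefficient_constant[OF nz D] ..
    also have "lin_Kinv2 (?B * (1 / D * (q / (X * Y * Z\<^sup>2)) ^ 2)) (- (?B * (1 / D) - ?C))
        = ?B \<odot> ((1 / D) \<odot> lin_Kinv2 ((q / (X * Y * Z\<^sup>2)) ^ 2) (- 1)) + ?C \<odot> 1"
    proof -
      have "?C \<odot> 1 = lin_Kinv2 0 ?C" by (simp add: lin_Kinv2_def)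
      then show ?thesis by (simp only: scaleU_lin_Kinv2 lin_Kinv2_add) (simp add: mult_ac)
    qed
    also have "w \<odot> (?H * \<dots>) = (?B * w) \<odot> hbinom (1 - int m - 1) c + (?C * w) \<odot> ?H"
      unfolding H by (simp only: distrib_left scaleU_add_right scaleU_simps mult_ac mult_1_right)
    also have "?B * w = qint (int (2 * m + 1)) * weight 1 (int a) (int b) (int c)"
      unfolding W Q pw by (simp only: mult_ac)
    also have "?C * w = qint (int (2 * m)) * weight 1 (int a) (int b) (int c - 1)"
      unfolding W Q pw by simp
    finally show ?thesis using Suc by simp
  qed
qed

section \<open>Comparison of the recursions\<close>

lemma t_mult_ordered_sum_odd:
  assumes "m \<ge> 1"
  shows "t * ordered_sum 1 (1 - int m) (2 * m - 1) = qint (int (2 * m)) \<odot> ordered_sum 0 (1 - int m) (2 * m)"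
proof -
  have "Suc (2 * m - 1) = 2 * m" using assms by simp
  then show ?thesis
    unfolding t_mult_ordered_sum unfolding ordered_sum_def scaleU_sum_right
    by (intro sum.cong) (auto simp: triples_def next_coeff_odd_to_even scaleU_simps)
qed

lemma t_mult_ordered_sum_even:
  assumes "m \<ge> 1"
  shows "t * ordered_sum 0 (1 - int m) (2 * m) = qint (int (2 * m + 1)) \<odot> ordered_sum 1 (- int m) (2 * m + 1)
     + qint (int (2 * m)) \<odot> ordered_sum 1 (1 - int m) (2 * m - 1)"
proof -
  let ?f = "\<lambda>a b c. if c = 0 then 0 else (qint (int (2 * m)) * weight 1 (int a) (int b) (int c - 1)) \<odot>
       (Echeck_dp a * hbinom (1 - int m) (c - 1) * F_dp b)"
  have m: "Suc (Suc (2 * m - 1)) = 2 * m + 1" "Suc (2 * m) = 2 * m + 1" using assms by simp_all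
  have "qint (int (2 * m)) \<odot> ordered_sum 1 (1 - int m) (2 * m - 1) = (\<Sum>(a, b, c)\<in>triples (2 * m - 1). ?f a b (Suc c))"
    unfolding ordered_sum_def scaleU_sum_right by (intro sum.cong) (auto simp: scaleU_simps)
  also have "\<dots> = (\<Sum>(a, b, c)\<in>triples (2 * m + 1). ?f a b c)"
    using sum_triples_shift_trd[of ?f "2 * m - 1"] unfolding m by simp
  finally have *: "qint (int (2 * m)) \<odot> ordered_sum 1 (1 - int m) (2 * m - 1) = \<dots>" .
  show ?thesis
    unfolding * t_mult_ordered_sum m
    unfolding ordered_sum_def scaleU_sum_right sum.distrib[symmetric]
  proof (intro sum.cong refl, clarify)
    fix a b c
    assume "(a, b, c) \<in> triples (2 * m + 1)"
    then have abc: "a + b + 2 * c = 2 * m + 1" by (simp add: triples_def)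
    show "Echeck_dp a * next_coeff 0 (1 - int m) a b c * F_dp b =
        qint (int (2 * m + 1)) \<odot> weight 1 (int a) (int b) (int c) \<odot> (Echeck_dp a * hbinom (- int m) c * F_dp b)
        + ?f a b c"
      unfolding next_coeff_even_to_odd[OF abc] distrib_left distrib_right scaleU_simps
      by (cases "c = 0") (simp_all only: simp_thms if_True if_False scaleU_simps add_0_right mult_zero_right mult_zero_left)
  qed
qed

lemma scaleU_cancel:
  assumes "c \<noteq> 0" "c \<odot> x = c \<odot> y"
  shows "x = y"
proof -
  have "(inverse c * c) \<odot> x = (inverse c * c) \<odot> y"
    by (simp only: scaleU_scaleU[symmetric] assms(2))
  then show ?thesis using assms(1) by (simp add: scaleU_one)
qed

lemma t_ev_eq_ordered_sum:
  assumes "m \<ge> 1"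
  shows "t_ev (2 * m - 1) = ordered_sum 1 (1 - int m) (2 * m - 1) \<and>
         t_ev (2 * m) = ordered_sum 0 (1 - int m) (2 * m)"
proof -
  have even: "t_ev (2 * m) = ordered_sum 0 (1 - int m) (2 * m)"
    if "t_ev (2 * m - 1) = ordered_sum 1 (1 - int m) (2 * m - 1)" "m \<ge> 1" for m
  proof (rule scaleU_cancel)
    show "qint (int (2 * m)) \<noteq> 0"
      using that(2) by (intro qint_nonzero) simp
    show "qint (int (2 * m)) \<odot> t_ev (2 * m) = qint (int (2 * m)) \<odot> ordered_sum 0 (1 - int m) (2 * m)"
      by (simp only: t_mult_t_ev_odd[OF that(2), symmetric] t_mult_ordered_sum_odd[OF that(2), symmetric] that(1))
  qed
  show ?thesis
    using assms
  proof (induction m rule: dec_induct)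
    case base
    have "triples 1 = {(1, 0, 0), (0, 1, 0)}"
      unfolding triples_def by auto arith
    then have "ordered_sum 1 0 1 = t"
      using q_minus_inverse_q_nonzero
      by (simp add: ordered_sum_def weight_def binom2_def hbinom_0 Echeck_dp_def F_dp_def qfact_def
          qint_def scaleU_simps t_def)
    then show ?case using even[of 1] t_ev_1 by simp
  next
    case (step m)
    have "qint (int (2 * m + 1)) \<odot> t_ev (2 * m + 1) = qint (int (2 * m + 1)) \<odot> ordered_sum 1 (- int m) (2 * m + 1)"
      using t_mult_ordered_sum_even[OF step(1)] t_mult_t_ev_even[OF step(1)] step(3)
      by (metis add_right_cancel)
    then have "t_ev (2 * m + 1) = ordered_sum 1 (- int m) (2 * m + 1)"
      by (rule scaleU_cancel[rotated]) (rule qint_nonzero, simp)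
    then show ?case using even[of "Suc m"] by simp
  qed
qed

lemma ordered_sum_eq_double_sum:
  "ordered_sum p r n = (\<Sum>c = 0..n div 2. \<Sum>a = 0..n - 2 * c.
     weight p (int a) (int (n - 2 * c - a)) (int c) \<odot> (Echeck_dp a * hbinom r c * F_dp (n - 2 * c - a)))"
  unfolding ordered_sum_def
  by (subst sum.Sigma, simp, simp,
      rule sum.reindex_bij_witness[where i = "\<lambda>(c, a). (a, n - 2 * c - a, c)" and j = "\<lambda>(a, b, c). (c, a)"])
     (auto simp: triples_def)

theorem theorem2p5:
  fixes m :: nat
  assumes "m \<ge> 1"
  shows
    "t_ev (2 * m) =
       (\<Sum>c = 0..m. \<Sum>a = 0..2 * m - 2 * c.
          q powi (binom2 (2 * int c) - int a * (2 * int m - 2 * int c - int a)) \<odot>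
            (Echeck_dp a * hbinom (1 - int m) c * F_dp (2 * m - 2 * c - a)))
     \<and> t_ev (2 * m - 1) =
       (\<Sum>c = 0..m - 1. \<Sum>a = 0..2 * m - 1 - 2 * c.
          q powi (binom2 (2 * int c + 1) - int a * (2 * int m - 1 - 2 * int c - int a)) \<odot>
            (Echeck_dp a * hbinom (1 - int m) c * F_dp (2 * m - 1 - 2 * c - a)))"
proof -
  have d: "2 * m div 2 = m" "(2 * m - 1) div 2 = m - 1" using assms by auto
  show ?thesis
    unfolding conjunct1[OF t_ev_eq_ordered_sum[OF assms]] conjunct2[OF t_ev_eq_ordered_sum[OF assms]]
      ordered_sum_eq_double_sum d
    by (intro conjI sum.cong refl arg_cong2[of _ _ _ _ "(\<odot>)"])
       (use assms in \<open>auto simp: weight_def of_nat_diff algebra_simps\<close>)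
qed

end
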